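(* Let $k\ge2$, $n\ge1$, let $S_k$ act on $[k]^n$ by $(g\cdot x)_i=g(x_i)$, with classical Burnside kernel $K_n$ on $[k]^n$ and dual Burnside kernel $Q_n$ on $S_k^*$. Let $I_k:=\{1,\dots,k\}\setminus\{k-1\}$, $C_s:=\{g\in S_k^*:|\mathrm{Fix}(g)|=s\}$ for $s\in I_k$, $\theta_{k,s}:={!}(k-s)/(k-s)!$, and $$P_m:=\{x\in[k]^n:r_x=m\},\qquad m\in\mathcal M_{k,n}:=\{1,\dots,\min\{k,n\}\}.$$ The pair of partitions $\{C_s\}_{s\in I_k}$ of $S_k^*$, $\{P_m\}_{m\in\mathcal M_{k,n}}$ of $[k]^n$ is compatible with the legs $A,B$. Define, for $r,s\in I_k$ and $m\in\mathcal M_{k,n}$, $$\bar A^{\#}(r,m):=\frac{\binom rmS(n,m)m!}{r^n},\qquad \bar B^{\#}(m,s):=\frac{\binom{k-m}{s-m}\cdot{!}(k-s)}{(k-m)!}.$$ Then the lumped kernels $\bar Q^{\#}$ of $Q_n$ by $\{C_s\}$ and $\bar K^{\#}$ of $K_n$ by $\{P_m\}$ satisfy $$\bar Q^{\#}=\bar A^{\#}\bar B^{\#},\qquad \bar K^{\#}=\bar B^{\#}\bar A^{\#},$$ and $$\mathrm{Spec}_{\ne0}(\bar Q^{\#})=\mathrm{Spec}_{\ne0}(\bar K^{\#}),\qquad \mathrm{Spec}(\bar Q^{\#})\subseteq\mathrm{Spec}(Q_n),\qquad \mathrm{Spec}(\bar K^{\#})\subseteq\mathrm{Spec}(K_n).$$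 For $r,s\in I_k$, $$\bar Q^{\#}(r,s)=\theta_{k,s}\frac1{r^n}\sum_{m=1}^{\min\{r,s,n\}}\binom rmS(n,m)\frac{m!}{(s-m)!}=\theta_{k,s}\,\mathbb E\big[(s-R_{r,n})!^{-1}\big]=\theta_{k,s}\frac{n!}{r^n}[u^n][z^s]\,e^z(1+z(e^u-1))^r.$$ The stationary laws are $$\bar\pi_Q^{\#}(s)=\frac{\binom ks\cdot{!}(k-s)\,s^n}{k!\,Z_{k,n}}=\frac{\theta_{k,s}}{Z_{k,n}}\frac{s^n}{s!},\qquad \bar\pi_K^{\#}(m)=\frac{S(n,m)}{Z_{k,n}}.$$
   Context: $[k]=\{1,\dots,k\}$; $\mathrm{Fix}(g)=\{a\in[k]:g(a)=a\}$; $r_x:=|\{x_1,\dots,x_n\}|$ is the number of distinct symbols of $x$; $S(n,m)$ is the Stirling number of the second kind; ${!}m$ is the number of derangements of $m$ symbols (${!}0=1$); $Z_{k,n}:=\sum_{r=0}^{\min\{k,n\}}S(n,r)$; $R_{r,n}$ is the number of distinct symbols used by a uniform random word in $[r]^n$; $[u^n],[z^s]$ denote coefficient extraction. Conventions: $(q!)^{-1}=0$ for $q<0$, and $\binom ab=0$ when $b\notin\{0,\dots,a\}$. For $G=S_k$ acting on $X=[k]^n$: $X_g=\{x:g\cdot x=x\}$, $G_x=\{g:g\cdot x=x\}$, $S_k^*=\{g\in S_k:\mathrm{Fix}(g)\ne\varnothing\}$; $K_n(x,y)=\frac1{|G_x|}\sum_{g\in G_x\cap G_y}\frac1{|X_g|}$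 on $X$ and $Q_n(g,h)=\frac1{|X_g|}\sum_{x\in X_g\cap X_h}\frac1{|G_x|}$ on $S_k^*$, with stationary laws $\pi_K(x)=(k-r_x)!/(k!Z_{k,n})$ and $\pi_Q(g)=|\mathrm{Fix}(g)|^n/(k!Z_{k,n})$. The legs are $A(g,x)=\mathbf 1_{\{x\in X_g\}}/|X_g|$ and $B(x,h)=\mathbf 1_{\{h\in G_x\}}/|G_x|$. Partitions $\{C_\alpha\}$ of $S_k^*$ and $\{D_i\}$ of $X$ are compatible with $A,B$ if $\sum_{x\in D_i}A(g,x)$ is independent of $g\in C_\alpha$ and $\sum_{g\in C_\alpha}B(x,g)$ is independent of $x\in D_i$, for all $\alpha,i$. The lumped kernel of a kernel $P$ strongly lumpable by a partition $\{B_i\}$ is $\bar P(B_i,B_j)=\sum_{y\in B_j}P(x,y)$ ($x\in B_i$, the sum being independent of $x\in B_i$), with stationary law the pushforward of that of $P$; blocks $C_s$, $P_m$ are labelled by $s$, $m$. $\mathrm{Spec}_{\ne0}$ denotes nonzero eigenvalues. *)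

theory Defs
  imports
    "HOL-Probability.Probability"
    "HOL-Combinatorics.Combinatorics"
    "HOL-Computational_Algebra.Formal_Power_Series"
begin

section \<open>Kernels on finite sets\<close>

text \<open>
  A kernel on a finite set \<open>S\<close> is a function \<open>P :: 'a \<Rightarrow> 'a \<Rightarrow> real\<close> of which only the values on
  \<open>S \<times> S\<close> matter.  Eigenvalues are complex, with eigenvectors restricted to \<open>S\<close>; the spectrum is
  the set of eigenvalues.
\<close>

definition kernel_eigenvalue :: "'a set \<Rightarrow> ('a \<Rightarrow> 'a \<Rightarrow> real) \<Rightarrow> complex \<Rightarrow> bool" where
  "kernel_eigenvalue S P c \<longleftrightarrow>
     (\<exists>f :: 'a \<Rightarrow> complex. (\<exists>x\<in>S. f x \<noteq> 0) \<and>
        (\<forall>x\<in>S. (\<Sum>y\<in>S. complex_of_real (P x y) * f y) = c * f x))"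

definition kernel_Spec :: "'a set \<Rightarrow> ('a \<Rightarrow> 'a \<Rightarrow> real) \<Rightarrow> complex set" where
  "kernel_Spec S P = {c. kernel_eigenvalue S P c}"

definition kernel_Spec_nz :: "'a set \<Rightarrow> ('a \<Rightarrow> 'a \<Rightarrow> real) \<Rightarrow> complex set" where
  "kernel_Spec_nz S P = kernel_Spec S P - {0}"

definition stationary_law :: "'a set \<Rightarrow> ('a \<Rightarrow> 'a \<Rightarrow> real) \<Rightarrow> ('a \<Rightarrow> real) \<Rightarrow> bool" where
  "stationary_law S P p \<longleftrightarrow>
     (\<forall>x\<in>S. 0 \<le> p x) \<and> (\<Sum>x\<in>S. p x) = 1 \<and> (\<forall>y\<in>S. (\<Sum>x\<in>S. p x * P x y) = p y)"

definition indexed_partition :: "'a set \<Rightarrow> 'i set \<Rightarrow> ('i \<Rightarrow> 'a set) \<Rightarrow> bool" where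
  "indexed_partition S I B \<longleftrightarrow> partition_on S (B ` I) \<and> inj_on B I"

definition strongly_lumpable :: "'i set \<Rightarrow> ('i \<Rightarrow> 'a set) \<Rightarrow> ('a \<Rightarrow> 'a \<Rightarrow> real) \<Rightarrow> bool" where
  "strongly_lumpable I B P \<longleftrightarrow>
     (\<forall>i\<in>I. \<forall>j\<in>I. \<forall>x\<in>B i. \<forall>x'\<in>B i. (\<Sum>y\<in>B j. P x y) = (\<Sum>y\<in>B j. P x' y))"

text \<open>
  The lumped kernel as a kernel on labels; meaningful for labels of nonempty blocks when \<open>P\<close> is
  strongly lumpable, since then the described number exists and is unique.
\<close>

definition lumped :: "('i \<Rightarrow> 'a set) \<Rightarrow> ('a \<Rightarrow> 'a \<Rightarrow> real) \<Rightarrow> 'i \<Rightarrow> 'i \<Rightarrow> real" where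
  "lumped B P i j = (THE c. \<forall>x\<in>B i. (\<Sum>y\<in>B j. P x y) = c)"

definition lumped_law :: "('i \<Rightarrow> 'a set) \<Rightarrow> ('a \<Rightarrow> real) \<Rightarrow> 'i \<Rightarrow> real" where
  "lumped_law B p i = (\<Sum>x\<in>B i. p x)"

definition compatible ::
  "'i set \<Rightarrow> ('i \<Rightarrow> 'a set) \<Rightarrow> 'j set \<Rightarrow> ('j \<Rightarrow> 'b set) \<Rightarrow>
   ('a \<Rightarrow> 'b \<Rightarrow> real) \<Rightarrow> ('b \<Rightarrow> 'a \<Rightarrow> real) \<Rightarrow> bool" where
  "compatible I C J D A B \<longleftrightarrow>
     (\<forall>\<alpha>\<in>I. \<forall>i\<in>J.
        (\<forall>g\<in>C \<alpha>. \<forall>g'\<in>C \<alpha>. (\<Sum>x\<in>D i. A g x) = (\<Sum>x\<in>D i. A g' x)) \<and>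
        (\<forall>x\<in>D i. \<forall>x'\<in>D i. (\<Sum>g\<in>C \<alpha>. B x g) = (\<Sum>g\<in>C \<alpha>. B x' g)))"

section \<open>Combinatorial quantities\<close>

definition derangement_number :: "nat \<Rightarrow> nat" where
  "derangement_number m = card {g. g permutes {1..m} \<and> (\<forall>a\<in>{1..m}. g a \<noteq> a)}"

text \<open>
  Integer arguments, so that differences such as \<open>s - m\<close> are not truncated and the conventions
  for out-of-range arguments apply.
\<close>

definition binom :: "int \<Rightarrow> int \<Rightarrow> nat" where
  "binom a b = (if 0 \<le> b \<and> b \<le> a then nat a choose nat b else 0)"

definition inv_fact :: "int \<Rightarrow> real" where
  "inv_fact q = (if q < 0 then 0 else 1 / fact (nat q))"

definition Z_num :: "nat \<Rightarrow> nat \<Rightarrow> nat" where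
  "Z_num k n = (\<Sum>r = 0..min k n. Stirling n r)"

section \<open>The action of the symmetric group on words\<close>

text \<open>
  A word in \<open>[k]\<^sup>n\<close> is a list of length \<open>n\<close> over \<open>{1..k}\<close>; a permutation \<open>g\<close> acts by \<open>map g\<close>.
\<close>

definition words :: "nat \<Rightarrow> nat \<Rightarrow> nat list set" where
  "words k n = {x. length x = n \<and> set x \<subseteq> {1..k}}"

definition distinct_symbols :: "nat list \<Rightarrow> nat" where
  "distinct_symbols x = card (set x)"

definition Sym :: "nat \<Rightarrow> (nat \<Rightarrow> nat) set" where
  "Sym k = {g. g permutes {1..k}}"

definition Fix :: "nat \<Rightarrow> (nat \<Rightarrow> nat) \<Rightarrow> nat set" where
  "Fix k g = {a \<in> {1..k}. g a = a}"

definition Sym_star :: "nat \<Rightarrow> (nat \<Rightarrow> nat) set" where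
  "Sym_star k = {g \<in> Sym k. Fix k g \<noteq> {}}"

definition fixed_words :: "nat \<Rightarrow> nat \<Rightarrow> (nat \<Rightarrow> nat) \<Rightarrow> nat list set" where
  "fixed_words k n g = {x \<in> words k n. map g x = x}"

definition stabilizer :: "nat \<Rightarrow> nat list \<Rightarrow> (nat \<Rightarrow> nat) set" where
  "stabilizer k x = {g \<in> Sym k. map g x = x}"

text \<open>The law of the number of distinct symbols of a uniform random word in \<open>[r]\<^sup>n\<close>.\<close>

definition R_law :: "nat \<Rightarrow> nat \<Rightarrow> nat pmf" where
  "R_law r n = map_pmf distinct_symbols (pmf_of_set (words r n))"

section \<open>Burnside kernels, their legs and stationary laws\<close>

definition burnside_K :: "nat \<Rightarrow> nat \<Rightarrow> nat list \<Rightarrow> nat list \<Rightarrow> real" where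
  "burnside_K k n x y =
     1 / real (card (stabilizer k x)) *
       (\<Sum>g \<in> stabilizer k x \<inter> stabilizer k y. 1 / real (card (fixed_words k n g)))"

definition burnside_Q :: "nat \<Rightarrow> nat \<Rightarrow> (nat \<Rightarrow> nat) \<Rightarrow> (nat \<Rightarrow> nat) \<Rightarrow> real" where
  "burnside_Q k n g h =
     1 / real (card (fixed_words k n g)) *
       (\<Sum>x \<in> fixed_words k n g \<inter> fixed_words k n h. 1 / real (card (stabilizer k x)))"

definition leg_A :: "nat \<Rightarrow> nat \<Rightarrow> (nat \<Rightarrow> nat) \<Rightarrow> nat list \<Rightarrow> real" where
  "leg_A k n g x = of_bool (x \<in> fixed_words k n g) / real (card (fixed_words k n g))"

definition leg_B :: "nat \<Rightarrow> nat list \<Rightarrow> (nat \<Rightarrow> nat) \<Rightarrow> real" where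
  "leg_B k x h = of_bool (h \<in> stabilizer k x) / real (card (stabilizer k x))"

definition pi_K :: "nat \<Rightarrow> nat \<Rightarrow> nat list \<Rightarrow> real" where
  "pi_K k n x = fact (k - distinct_symbols x) / (fact k * real (Z_num k n))"

definition pi_Q :: "nat \<Rightarrow> nat \<Rightarrow> (nat \<Rightarrow> nat) \<Rightarrow> real" where
  "pi_Q k n g = real (card (Fix k g)) ^ n / (fact k * real (Z_num k n))"

section \<open>Lumping by fixed-point count and by number of distinct symbols\<close>

definition I_labels :: "nat \<Rightarrow> nat set" where
  "I_labels k = {1..k} - {k - 1}"

definition C_block :: "nat \<Rightarrow> nat \<Rightarrow> (nat \<Rightarrow> nat) set" where
  "C_block k s = {g \<in> Sym_star k. card (Fix k g) = s}"

definition M_labels :: "nat \<Rightarrow> nat \<Rightarrow> nat set" where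
  "M_labels k n = {1..min k n}"

definition P_block :: "nat \<Rightarrow> nat \<Rightarrow> nat \<Rightarrow> nat list set" where
  "P_block k n m = {x \<in> words k n. distinct_symbols x = m}"

definition theta :: "nat \<Rightarrow> nat \<Rightarrow> real" where
  "theta k s = real (derangement_number (k - s)) / fact (k - s)"

definition A_bar :: "nat \<Rightarrow> nat \<Rightarrow> nat \<Rightarrow> real" where
  "A_bar n r m = real (binom (int r) (int m)) * real (Stirling n m) * fact m / real r ^ n"

definition B_bar :: "nat \<Rightarrow> nat \<Rightarrow> nat \<Rightarrow> real" where
  "B_bar k m s =
     real (binom (int k - int m) (int s - int m)) * real (derangement_number (k - s)) / fact (k - m)"

definition Q_bar :: "nat \<Rightarrow> nat \<Rightarrow> nat \<Rightarrow> nat \<Rightarrow> real" where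
  "Q_bar k n = lumped (C_block k) (burnside_Q k n)"

definition K_bar :: "nat \<Rightarrow> nat \<Rightarrow> nat \<Rightarrow> nat \<Rightarrow> real" where
  "K_bar k n = lumped (P_block k n) (burnside_K k n)"

definition pi_Q_bar :: "nat \<Rightarrow> nat \<Rightarrow> nat \<Rightarrow> real" where
  "pi_Q_bar k n = lumped_law (C_block k) (pi_Q k n)"

definition pi_K_bar :: "nat \<Rightarrow> nat \<Rightarrow> nat \<Rightarrow> real" where
  "pi_K_bar k n = lumped_law (P_block k n) (pi_K k n)"

section \<open>The bivariate generating function\<close>

text \<open>
  Power series in \<open>z\<close> (outer \<open>fps\<close>) whose coefficients are power series in \<open>u\<close> (inner \<open>fps\<close>), so
  \<open>[u\<^sup>n][z\<^sup>s] F\<close> is \<open>fps_nth (fps_nth F s) n\<close>.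
\<close>

definition exp_z :: "real fps fps" where
  "exp_z = Abs_fps (\<lambda>i. fps_const (1 / fact i))"

definition exp_u :: "real fps fps" where
  "exp_u = fps_const (fps_exp 1)"

definition gen_fun :: "nat \<Rightarrow> real fps fps" where
  "gen_fun r = exp_z * (1 + fps_X * (exp_u - 1)) ^ r"

end

theory Submission
  imports Defs
begin

text \<open>
  Both Burnside kernels factor through the legs, as \<open>Q = A B\<close> and \<open>K = B A\<close>.  A permutation with
  \<open>r\<close> fixed points fixes \<open>r choose m * m! * S(n, m)\<close> words with \<open>m\<close> symbols, and the stabilizer of
  a word with \<open>m\<close> symbols is the symmetric group on the other \<open>k - m\<close> symbols, so every block sum
  of a leg depends only on the labels.  Hence the lumped kernels are \<open>A\<close>-bar times \<open>B\<close>-bar and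
  \<open>B\<close>-bar times \<open>A\<close>-bar, which have the same nonzero eigenvalues; eigenvectors of a lumped kernel
  lift to functions that are constant on blocks.  Stationarity follows from the balance
  \<open>\<pi>\<^sub>Q(g) A(g, x) = \<pi>\<^sub>K(x) B(x, g)\<close>.
\<close>

section \<open>Lumping of composed kernels\<close>

text \<open>Surjectivity of \<open>f\<close> onto \<open>I\<close> makes every fibre nonempty and
  gives distinct labels distinct fibres. Both block families arise as fibres of a statistic.\<close>

lemma indexed_partition_fibres:
  assumes "\<And>x. x \<in> S \<Longrightarrow> f x \<in> I" and "\<And>i. i \<in> I \<Longrightarrow> \<exists>x\<in>S. f x = i"
  shows "indexed_partition S I (\<lambda>i. {x \<in> S. f x = i})"
  unfolding indexed_partition_def
proof
  show "partition_on S ((\<lambda>i. {x \<in> S. f x = i}) ` I)"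
    using assms by (intro partition_onI) (auto simp: disjnt_def)
  show "inj_on (\<lambda>i. {x \<in> S. f x = i}) I"
    using assms(2) by (intro inj_onI) blast
qed

lemma indexed_partition_nonempty:
  "indexed_partition S I B \<Longrightarrow> i \<in> I \<Longrightarrow> B i \<noteq> {}"
  unfolding indexed_partition_def partition_on_def by auto

lemma indexed_partition_subset:
  "indexed_partition S I B \<Longrightarrow> i \<in> I \<Longrightarrow> B i \<subseteq> S"
  unfolding indexed_partition_def partition_on_def by auto

text \<open>The label function turns a function on \<open>I\<close> into one that is constant on
  blocks. Uniqueness of labels combines disjointness of the blocks with injectivity of
  \<open>B\<close>.\<close>

lemma indexed_partition_label:
  assumes "indexed_partition S I B"
  obtains lab where "\<And>x. x \<in> S \<Longrightarrow> lab x \<in> I" "\<And>x. x \<in> S \<Longrightarrow> x \<in> B (lab x)"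
    "\<And>i x. i \<in> I \<Longrightarrow> x \<in> B i \<Longrightarrow> lab x = i"
proof -
  have ex: "\<exists>i\<in>I. x \<in> B i" if "x \<in> S" for x
    using assms that unfolding indexed_partition_def partition_on_def by auto
  have un: "i = j" if "i \<in> I" "j \<in> I" "x \<in> B i" "x \<in> B j" for i j x
    using assms that unfolding indexed_partition_def partition_on_def disjoint_def inj_on_def
    by (metis disjoint_iff image_eqI)
  define lab where "lab x = (SOME i. i \<in> I \<and> x \<in> B i)" for x
  have lab: "lab x \<in> I \<and> x \<in> B (lab x)" if "\<exists>i\<in>I. x \<in> B i" for x
    unfolding lab_def by (rule someI_ex) (use that in blast)
  show thesis
    using lab ex un by (intro that[of lab]) blast+
qed

lemma finite_labels:
  "finite S \<Longrightarrow> indexed_partition S I B \<Longrightarrow> finite I"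
  unfolding indexed_partition_def by (metis finite_elements finite_imageD)

lemma sum_indexed_partition:
  assumes "finite S" "indexed_partition S I B"
  shows "sum f S = (\<Sum>i\<in>I. sum f (B i))"
proof -
  obtain lab where lab: "\<And>x. x \<in> S \<Longrightarrow> lab x \<in> I" "\<And>x. x \<in> S \<Longrightarrow> x \<in> B (lab x)"
    "\<And>i x. i \<in> I \<Longrightarrow> x \<in> B i \<Longrightarrow> lab x = i"
    using indexed_partition_label[OF assms(2)] by metis
  have eq: "B i = {x \<in> S. lab x = i}" if "i \<in> I" for i
    using lab that indexed_partition_subset[OF assms(2) that] by auto
  have "(\<Sum>i\<in>I. sum f (B i)) = (\<Sum>i\<in>I. sum f {x \<in> S. lab x = i})"
    by (intro sum.cong) (simp_all add: eq)
  also have "\<dots> = sum f S"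
    by (rule sum.group) (use assms lab in \<open>auto intro: finite_labels\<close>)
  finally show ?thesis by simp
qed

lemma lumped_eqI:
  assumes "B i \<noteq> {}" "\<And>x. x \<in> B i \<Longrightarrow> (\<Sum>y\<in>B j. P x y) = c"
  shows "lumped B P i j = c"
  unfolding lumped_def using assms by (intro the_equality) auto

text \<open>Source of both product formulas: once the sums are exchanged, the inner sum over
  \<open>E\<close> is constant on each block \<open>D i\<close> and can be pulled out, which leaves
  a block sum of \<open>A\<close>.\<close>

lemma block_sum_kernel_comp:
  fixes A :: "'a \<Rightarrow> 'b \<Rightarrow> real" and B :: "'b \<Rightarrow> 'c \<Rightarrow> real"
  assumes T: "finite T" "indexed_partition T J D"
    and A: "\<And>i. i \<in> J \<Longrightarrow> (\<Sum>y\<in>D i. A x y) = a i"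
    and B: "\<And>i y. i \<in> J \<Longrightarrow> y \<in> D i \<Longrightarrow> (\<Sum>z\<in>E. B y z) = b i"
  shows "(\<Sum>z\<in>E. \<Sum>y\<in>T. A x y * B y z) = (\<Sum>i\<in>J. a i * b i)"
proof -
  have "(\<Sum>z\<in>E. \<Sum>y\<in>T. A x y * B y z) = (\<Sum>y\<in>T. A x y * (\<Sum>z\<in>E. B y z))"
    by (subst sum.swap) (simp add: sum_distrib_left)
  also have "\<dots> = (\<Sum>i\<in>J. \<Sum>y\<in>D i. A x y * (\<Sum>z\<in>E. B y z))"
    by (rule sum_indexed_partition[OF T])
  also have "\<dots> = (\<Sum>i\<in>J. a i * b i)"
    by (intro sum.cong refl) (simp add: B A flip: sum_distrib_right)
  finally show ?thesis .
qed

section \<open>Spectra of lumped and of composed kernels\<close>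

lemma kernel_Spec_lumped_subset:
  assumes S: "finite S" "indexed_partition S I B"
    and P: "\<And>i j x. i \<in> I \<Longrightarrow> j \<in> I \<Longrightarrow> x \<in> B i \<Longrightarrow> (\<Sum>y\<in>B j. P x y) = R i j"
  shows "kernel_Spec I R \<subseteq> kernel_Spec S P"
proof
  fix c assume "c \<in> kernel_Spec I R"
  then obtain f where nz: "\<exists>i\<in>I. f i \<noteq> 0"
    and ev: "\<And>i. i \<in> I \<Longrightarrow> (\<Sum>j\<in>I. complex_of_real (R i j) * f j) = c * f i"
    unfolding kernel_Spec_def kernel_eigenvalue_def by blast
  obtain lab where lab: "\<And>x. x \<in> S \<Longrightarrow> lab x \<in> I" "\<And>x. x \<in> S \<Longrightarrow> x \<in> B (lab x)"
    "\<And>i x. i \<in> I \<Longrightarrow> x \<in> B i \<Longrightarrow> lab x = i"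
    using indexed_partition_label[OF S(2)] by metis
  \<comment> \<open>The lift of a nonzero eigenvector is nonzero because every block contains a
    point.\<close>
  have "\<exists>x\<in>S. f (lab x) \<noteq> 0"
  proof -
    obtain i where i: "i \<in> I" "f i \<noteq> 0" using nz by blast
    obtain x where "x \<in> B i" using indexed_partition_nonempty[OF S(2) i(1)] by blast
    then show ?thesis
      using i lab(3) indexed_partition_subset[OF S(2) i(1)] by (intro bexI[of _ x]) auto
  qed
  moreover have "(\<Sum>y\<in>S. complex_of_real (P x y) * f (lab y)) = c * f (lab x)" if "x \<in> S" for x
  proof -
    have "(\<Sum>y\<in>S. complex_of_real (P x y) * f (lab y))
        = (\<Sum>j\<in>I. \<Sum>y\<in>B j. complex_of_real (P x y) * f (lab y))"
      by (rule sum_indexed_partition[OF S])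
    \<comment> \<open>The lift has the constant value \<open>f j\<close> on \<open>B j\<close>, so
      \<open>P\<close> enters only through its block sums.\<close>
    also have "\<dots> = (\<Sum>j\<in>I. complex_of_real (\<Sum>y\<in>B j. P x y) * f j)"
      by (intro sum.cong refl) (simp add: lab(3) sum_distrib_right)
    also have "\<dots> = (\<Sum>j\<in>I. complex_of_real (R (lab x) j) * f j)"
      using P[OF lab(1)[OF that] _ lab(2)[OF that]] by (intro sum.cong) simp_all
    finally show ?thesis using ev lab(1)[OF that] by simp
  qed
  ultimately show "c \<in> kernel_Spec S P"
    unfolding kernel_Spec_def kernel_eigenvalue_def by (auto intro!: exI[of _ "\<lambda>x. f (lab x)"])
qed

text \<open>If \<open>f\<close> is an eigenvector of \<open>A B\<close> for \<open>c\<close>, then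
  \<open>B f\<close> is one of \<open>B A\<close>. It cannot vanish, since
  \<open>A (B f) = c f\<close> and \<open>c\<close> is nonzero. Exchanging \<open>A\<close> and
  \<open>B\<close> gives the reverse inclusion.\<close>

lemma kernel_Spec_nz_comp_subset:
  fixes A :: "'a \<Rightarrow> 'b \<Rightarrow> real" and B :: "'b \<Rightarrow> 'a \<Rightarrow> real"
  assumes P: "\<And>i i'. i \<in> I \<Longrightarrow> i' \<in> I \<Longrightarrow> P i i' = (\<Sum>j\<in>J. A i j * B j i')"
    and R: "\<And>j j'. j \<in> J \<Longrightarrow> j' \<in> J \<Longrightarrow> R j j' = (\<Sum>i\<in>I. B j i * A i j')"
  shows "kernel_Spec_nz I P \<subseteq> kernel_Spec_nz J R"
proof
  fix c assume "c \<in> kernel_Spec_nz I P"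
  then obtain f where c: "c \<noteq> 0" and nz: "\<exists>i\<in>I. f i \<noteq> 0"
    and ev: "\<And>i. i \<in> I \<Longrightarrow> (\<Sum>i'\<in>I. complex_of_real (P i i') * f i') = c * f i"
    unfolding kernel_Spec_nz_def kernel_Spec_def kernel_eigenvalue_def by blast
  define g where "g j = (\<Sum>i\<in>I. complex_of_real (B j i) * f i)" for j
  have Ag: "(\<Sum>j\<in>J. complex_of_real (A i j) * g j) = c * f i" if "i \<in> I" for i
  proof -
    have "(\<Sum>j\<in>J. complex_of_real (A i j) * g j)
        = (\<Sum>i'\<in>I. \<Sum>j\<in>J. complex_of_real (A i j) * complex_of_real (B j i') * f i')"
      unfolding g_def by (simp add: sum_distrib_left mult.assoc) (rule sum.swap)
    also have "\<dots> = (\<Sum>i'\<in>I. complex_of_real (P i i') * f i')"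
      by (intro sum.cong refl) (simp add: P that sum_distrib_right)
    finally show ?thesis using ev that by simp
  qed
  have "\<exists>j\<in>J. g j \<noteq> 0"
  proof (rule ccontr)
    assume "\<not> ?thesis"
    then have "c * f i = 0" if "i \<in> I" for i
      using Ag[OF that] by simp
    with c nz show False by simp
  qed
  moreover have "(\<Sum>j'\<in>J. complex_of_real (R j j') * g j') = c * g j" if "j \<in> J" for j
  proof -
    have "(\<Sum>j'\<in>J. complex_of_real (R j j') * g j')
        = (\<Sum>j'\<in>J. \<Sum>i\<in>I. complex_of_real (B j i) * complex_of_real (A i j') * g j')"
      by (intro sum.cong refl) (simp add: R that sum_distrib_right)
    also have "\<dots> = (\<Sum>i\<in>I. complex_of_real (B j i) * (\<Sum>j'\<in>J. complex_of_real (A i j') * g j'))"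
      by (subst sum.swap) (simp add: sum_distrib_left mult.assoc)
    also have "\<dots> = (\<Sum>i\<in>I. complex_of_real (B j i) * (c * f i))"
      by (intro sum.cong refl) (simp add: Ag)
    also have "\<dots> = c * g j"
      unfolding g_def by (simp add: sum_distrib_left mult.left_commute)
    finally show ?thesis .
  qed
  ultimately show "c \<in> kernel_Spec_nz J R"
    using c unfolding kernel_Spec_nz_def kernel_Spec_def kernel_eigenvalue_def by blast
qed

section \<open>Stationary laws under lumping and composition\<close>

lemma stationary_law_lumped:
  assumes S: "finite S" "indexed_partition S I B"
    and P: "\<And>i j x. i \<in> I \<Longrightarrow> j \<in> I \<Longrightarrow> x \<in> B i \<Longrightarrow> (\<Sum>y\<in>B j. P x y) = R i j"
    and p: "stationary_law S P p"
  shows "stationary_law I R (lumped_law B p)"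
proof -
  have sub: "B i \<subseteq> S" if "i \<in> I" for i
    using indexed_partition_subset[OF S(2) that] .
  have "0 \<le> lumped_law B p i" if "i \<in> I" for i
    using p sub[OF that] unfolding lumped_law_def stationary_law_def by (intro sum_nonneg) auto
  moreover have "(\<Sum>i\<in>I. lumped_law B p i) = 1"
    using p unfolding lumped_law_def stationary_law_def
    by (simp flip: sum_indexed_partition[OF S])
  moreover have "(\<Sum>i\<in>I. lumped_law B p i * R i j) = lumped_law B p j" if "j \<in> I" for j
  proof -
    have "(\<Sum>i\<in>I. lumped_law B p i * R i j) = (\<Sum>i\<in>I. \<Sum>x\<in>B i. p x * (\<Sum>y\<in>B j. P x y))"
      unfolding lumped_law_def by (intro sum.cong refl) (simp add: P that sum_distrib_right)
    also have "\<dots> = (\<Sum>x\<in>S. p x * (\<Sum>y\<in>B j. P x y))"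
      by (rule sum_indexed_partition[OF S, symmetric])
    also have "\<dots> = (\<Sum>y\<in>B j. \<Sum>x\<in>S. p x * P x y)"
      by (subst sum.swap) (simp add: sum_distrib_left)
    also have "\<dots> = lumped_law B p j"
      using p sub[OF that] unfolding lumped_law_def stationary_law_def by (intro sum.cong) auto
    finally show ?thesis .
  qed
  ultimately show ?thesis unfolding stationary_law_def by blast
qed

text \<open>The balance says that \<open>p\<close> followed by \<open>A\<close> and \<open>q\<close>
  followed by \<open>B\<close> put the same weight on each pair. It is applied twice: at
  \<open>x\<close>, to sum out a full row of \<open>B\<close>, and at \<open>x'\<close>, to return
  from \<open>q\<close> to \<open>p\<close>.\<close>

lemma stationary_law_comp:
  fixes A :: "'a \<Rightarrow> 'b \<Rightarrow> real" and B :: "'b \<Rightarrow> 'a \<Rightarrow> real"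
  assumes P: "\<And>x x'. x \<in> S \<Longrightarrow> x' \<in> S \<Longrightarrow> P x x' = (\<Sum>y\<in>T. A x y * B y x')"
    and A: "\<And>x. x \<in> S \<Longrightarrow> (\<Sum>y\<in>T. A x y) = 1" and B: "\<And>y. y \<in> T \<Longrightarrow> (\<Sum>x\<in>S. B y x) = 1"
    and pq: "\<And>x y. x \<in> S \<Longrightarrow> y \<in> T \<Longrightarrow> p x * A x y = q y * B y x"
    and p: "\<And>x. x \<in> S \<Longrightarrow> 0 \<le> p x" "sum p S = 1"
  shows "stationary_law S P p"
proof -
  have "(\<Sum>x\<in>S. p x * P x x') = p x'" if x': "x' \<in> S" for x'
  proof -
    have "(\<Sum>x\<in>S. p x * P x x') = (\<Sum>x\<in>S. \<Sum>y\<in>T. (p x * A x y) * B y x')"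
      by (intro sum.cong refl) (simp add: P x' sum_distrib_left mult.assoc)
    also have "\<dots> = (\<Sum>x\<in>S. \<Sum>y\<in>T. q y * B y x' * B y x)"
      by (intro sum.cong refl) (simp add: pq)
    also have "\<dots> = (\<Sum>y\<in>T. q y * B y x' * (\<Sum>x\<in>S. B y x))"
      by (subst sum.swap) (simp add: sum_distrib_left)
    also have "\<dots> = (\<Sum>y\<in>T. p x' * A x' y)"
      by (intro sum.cong refl) (simp add: B pq x')
    also have "\<dots> = p x'"
      by (simp add: A x' flip: sum_distrib_left)
    finally show ?thesis .
  qed
  then show ?thesis using p unfolding stationary_law_def by blast
qed

section \<open>Counting words and permutations\<close>

lemma finite_lists_card_set: "finite A \<Longrightarrow> finite {xs. length xs = n \<and> set xs \<subseteq> A \<and> Q xs}"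
  by (rule finite_subset[OF _ finite_lists_length_eq[of A n]]) auto

text \<open>Induction on the length by the head of the list: it either occurs in the tail
  (\<open>?S1\<close>, with \<open>Suc j\<close> choices) or is new (\<open>?S2\<close>, with
  \<open>card A - j\<close> choices). This is the Stirling recurrence weighted by the falling
  factorial of \<open>card A\<close>.\<close>

lemma card_lists_card_set:
  assumes "finite A"
  shows "card {xs. length xs = n \<and> set xs \<subseteq> A \<and> card (set xs) = m}
    = (card A choose m) * fact m * Stirling n m"
proof (induction n arbitrary: m)
  case 0
  have "{xs. length xs = 0 \<and> set xs \<subseteq> A \<and> card (set xs) = m} = (if m = 0 then {[]} else {})"
    by auto
  then show ?case by (cases m) auto
next
  case (Suc n)
  let ?L = "\<lambda>n m. {xs. length xs = n \<and> set xs \<subseteq> A \<and> card (set xs) = m}"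
  show ?case
  proof (cases m)
    case 0
    have "?L (Suc n) 0 = {}" by auto
    with 0 show ?thesis by simp
  next
    case (Suc j)
    let ?S1 = "Sigma (?L n (Suc j)) set" and ?S2 = "Sigma (?L n j) (\<lambda>xs. A - set xs)"
    have "?L (Suc n) (Suc j) = (\<lambda>(xs, a). a # xs) ` (?S1 \<union> ?S2)"
    proof (intro equalityI subsetI)
      fix ys assume ys: "ys \<in> ?L (Suc n) (Suc j)"
      then obtain a xs where "ys = a # xs" by (cases ys) auto
      with ys show "ys \<in> (\<lambda>(xs, a). a # xs) ` (?S1 \<union> ?S2)"
        by (intro image_eqI[of _ _ "(xs, a)"]) (auto simp: card_insert_if split: if_splits)
    qed (auto simp: card_insert_if)
    moreover have "inj_on (\<lambda>(xs, a). a # xs) (?S1 \<union> ?S2)"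
      by (auto simp: inj_on_def)
    ultimately have "card (?L (Suc n) (Suc j)) = card (?S1 \<union> ?S2)"
      by (simp add: card_image)
    also have "\<dots> = card ?S1 + card ?S2"
      using assms by (intro card_Un_disjoint) (auto intro!: finite_SigmaI finite_lists_card_set)
    also have "card ?S1 = Suc j * card (?L n (Suc j))"
      using assms by (subst card_SigmaI) (auto intro: finite_lists_card_set)
    also have "card ?S2 = (\<Sum>xs\<in>?L n j. card A - j)"
      using assms
      by (subst card_SigmaI) (auto intro!: finite_lists_card_set sum.cong simp: card_Diff_subset)
    also have "\<dots> = (card A - j) * card (?L n j)"
      by simp
    also have "Suc j * card (?L n (Suc j)) + (card A - j) * card (?L n j)
      = Suc j * ((card A choose Suc j) * fact (Suc j) * Stirling n (Suc j))
        + (card A - j) * ((card A choose j) * fact j * Stirling n j)"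
      by (simp only: Suc.IH)
    also have "\<dots> = (card A choose Suc j) * fact (Suc j) * Stirling (Suc n) (Suc j)"
    proof -
      \<comment> \<open>Absorption identity. Both sides are 0 for \<open>card A \<le> j\<close>, so
        the truncated difference is harmless.\<close>
      have "(card A - j) * (card A choose j) = Suc j * (card A choose Suc j)"
        by (metis binomial_absorb_comp binomial_absorption diff_Suc_1 mult.commute
            binomial_eq_0_iff mult_0_right not_less_eq Suc_diff_Suc)
      then have "(card A - j) * ((card A choose j) * fact j * Stirling n j)
        = Suc j * (card A choose Suc j) * fact j * Stirling n j"
        by (metis mult.assoc)
      then show ?thesis by (simp only: Stirling.simps fact_Suc) (simp add: algebra_simps)
    qed
    finally show ?thesis using Suc by simp
  qed
qed

section \<open>Derangements and permutations with prescribed fixed points\<close>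

lemma card_derangements:
  assumes "finite D"
  shows "card {g. g permutes D \<and> (\<forall>a\<in>D. g a \<noteq> a)} = derangement_number (card D)"
proof -
  obtain f where f: "bij_betw f D {1..card D}"
    using finite_same_card_bij[of D "{1..card D}"] assms by auto
  \<comment> \<open>Conjugation by \<open>f\<close>: it carries permutations of \<open>D\<close> to
    permutations of \<open>{1..card D}\<close>, and fixed points correspond under
    \<open>f\<close>.\<close>
  let ?\<phi> = "\<lambda>\<pi> x. if x \<in> {1..card D} then f (\<pi> (inv_into D f x)) else x"
  let ?S = "{g. g permutes D \<and> (\<forall>a\<in>D. g a \<noteq> a)}"
  have \<phi>: "bij_betw ?\<phi> {\<pi>. \<pi> permutes D} {\<pi>. \<pi> permutes {1..card D}}"
    by (rule bij_betw_permutations[OF f])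
  have iff: "(\<forall>b\<in>{1..card D}. ?\<phi> g b \<noteq> b) \<longleftrightarrow> (\<forall>a\<in>D. g a \<noteq> a)" if g: "g permutes D" for g
  proof -
    have "(\<forall>b\<in>{1..card D}. h b \<noteq> b) \<longleftrightarrow> (\<forall>a\<in>D. h (f a) \<noteq> f a)" for h :: "nat \<Rightarrow> nat"
      unfolding bij_betw_imp_surj_on[OF f, symmetric] by simp
    then have "(\<forall>b\<in>{1..card D}. ?\<phi> g b \<noteq> b) \<longleftrightarrow> (\<forall>a\<in>D. ?\<phi> g (f a) \<noteq> f a)" .
    also have "?\<phi> g (f a) = f a \<longleftrightarrow> g a = a" if "a \<in> D" for a
      using f that g permutes_in_image[OF g, of a]
      by (auto simp: bij_betw_def inj_on_eq_iff)
    then have "(\<forall>a\<in>D. ?\<phi> g (f a) \<noteq> f a) \<longleftrightarrow> (\<forall>a\<in>D. g a \<noteq> a)"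
      by (intro ball_cong refl) (simp only: )
    finally show ?thesis .
  qed
  have inj: "inj_on ?\<phi> ?S"
    by (rule inj_on_subset[OF bij_betw_imp_inj_on[OF \<phi>]]) blast
  have "?\<phi> ` ?S = {g. g permutes {1..card D} \<and> (\<forall>a\<in>{1..card D}. g a \<noteq> a)}"
  proof -
    have "?\<phi> ` ?S = {g \<in> ?\<phi> ` {\<pi>. \<pi> permutes D}. \<forall>a\<in>{1..card D}. g a \<noteq> a}"
      using iff by blast
    then show ?thesis using \<phi> by (simp add: bij_betw_def)
  qed
  then show ?thesis
    unfolding derangement_number_def
    using card_image[OF inj] by (simp only:)
qed

lemma derangement_number_pos:
  assumes "m \<noteq> 1"
  shows "derangement_number m > 0"
proof -
  \<comment> \<open>The cycle 1, 2, ..., \<open>m\<close>, 1 moves every point as soon as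
    \<open>m\<close> is at least 2; for \<open>m = 0\<close> there is no point to move.\<close>
  define g where "g a = (if a \<in> {1..m} then if a = m then 1 else Suc a else a)" for a :: nat
  have "inj_on g {1..m}" "g ` {1..m} \<subseteq> {1..m}"
    by (auto simp: g_def inj_on_def Suc_le_eq split: if_splits)
  then have "bij_betw g {1..m} {1..m}"
    by (simp add: bij_betw_def endo_inj_surj)
  then have "g permutes {1..m}"
    by (rule bij_imp_permutes) (auto simp: g_def)
  moreover have "\<forall>a\<in>{1..m}. g a \<noteq> a"
    using assms by (auto simp: g_def)
  moreover have "finite {g. g permutes {1..m} \<and> (\<forall>a\<in>{1..m}. g a \<noteq> a)}"
    by (rule finite_subset[OF _ finite_permutations[of "{1..m}"]]) auto
  ultimately show ?thesis
    unfolding derangement_number_def by (subst card_gt_0_iff) blast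
qed

lemma permutes_fixing_iff:
  assumes "F \<subseteq> A"
  shows "g permutes A \<and> (\<forall>a\<in>F. g a = a) \<longleftrightarrow> g permutes A - F"
proof
  assume "g permutes A \<and> (\<forall>a\<in>F. g a = a)"
  then show "g permutes A - F" by (auto intro: permutes_superset)
next
  assume g: "g permutes A - F"
  then show "g permutes A \<and> (\<forall>a\<in>F. g a = a)"
    by (auto intro: permutes_subset permutes_not_in)
qed

text \<open>Adjoining \<open>F\<close> matches the subsets of \<open>A - F\<close> of size
  \<open>s - card F\<close> with the sets counted; \<open>card F \<le> s\<close> keeps this
  difference genuine.\<close>

lemma card_subsets_between:
  assumes "finite A" "F \<subseteq> A" "card F \<le> s"
  shows "card {S. F \<subseteq> S \<and> S \<subseteq> A \<and> card S = s} = (card A - card F) choose (s - card F)"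
proof -
  have fin: "finite F" using assms finite_subset by blast
  have "bij_betw (\<lambda>T. F \<union> T) {T. T \<subseteq> A - F \<and> card T = s - card F}
      {S. F \<subseteq> S \<and> S \<subseteq> A \<and> card S = s}"
  proof (rule bij_betw_byWitness[where f' = "\<lambda>S. S - F"])
    show "(\<union>) F ` {T. T \<subseteq> A - F \<and> card T = s - card F} \<subseteq> {S. F \<subseteq> S \<and> S \<subseteq> A \<and> card S = s}"
    proof clarify
      fix T assume T: "T \<subseteq> A - F" "card T = s - card F"
      then have "card (F \<union> T) = card F + card T"
        using assms fin by (intro card_Un_disjoint) (auto intro: finite_subset)
      then show "F \<subseteq> F \<union> T \<and> F \<union> T \<subseteq> A \<and> card (F \<union> T) = s"
        using T assms by auto
    qed
    show "(\<lambda>S. S - F) ` {S. F \<subseteq> S \<and> S \<subseteq> A \<and> card S = s} \<subseteq> {T. T \<subseteq> A - F \<and> card T = s - card F}"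
      using fin by (auto simp: card_Diff_subset)
  qed auto
  then have "card {S. F \<subseteq> S \<and> S \<subseteq> A \<and> card S = s} = card {T. T \<subseteq> A - F \<and> card T = s - card F}"
    by (simp add: bij_betw_same_card)
  then show ?thesis
    using assms fin by (simp add: n_subsets card_Diff_subset)
qed

text \<open>Permutations are sorted by their exact fixed point set \<open>S\<close>. Given
  \<open>S\<close>, what remains is a derangement of \<open>A - S\<close>, so each class has the
  same size. Taking \<open>F\<close> empty counts a block of permutations, taking
  \<open>F = set x\<close> the part of it that stabilizes \<open>x\<close>.\<close>

lemma card_permutations_fixing:
  assumes A: "finite A" "F \<subseteq> A" and s: "card F \<le> s"
  shows "card {g. g permutes A \<and> (\<forall>a\<in>F. g a = a) \<and> card {a\<in>A. g a = a} = s}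
    = ((card A - card F) choose (s - card F)) * derangement_number (card A - s)"
proof -
  let ?T = "{S. F \<subseteq> S \<and> S \<subseteq> A \<and> card S = s}"
  let ?G = "\<lambda>S. {g. g permutes A \<and> {a\<in>A. g a = a} = S}"
  have "{g. g permutes A \<and> (\<forall>a\<in>F. g a = a) \<and> card {a\<in>A. g a = a} = s} = (\<Union>S\<in>?T. ?G S)"
    using A by auto
  also have "card \<dots> = (\<Sum>S\<in>?T. card (?G S))"
    using A by (intro card_UN_disjoint) (auto intro: finite_subset[OF _ finite_permutations[OF A(1)]])
  also have "\<dots> = (\<Sum>S\<in>?T. derangement_number (card A - s))"
  proof (intro sum.cong refl)
    fix S assume S: "S \<in> ?T"
    have "?G S = {g. (g permutes A \<and> (\<forall>a\<in>S. g a = a)) \<and> (\<forall>a\<in>A - S. g a \<noteq> a)}"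
      using S by auto
    also have "\<dots> = {g. g permutes A - S \<and> (\<forall>a\<in>A - S. g a \<noteq> a)}"
      using permutes_fixing_iff[of S A] S by auto
    also have "card \<dots> = derangement_number (card (A - S))"
      using A by (intro card_derangements) simp
    finally show "card (?G S) = derangement_number (card A - s)"
      using S A by (simp add: card_Diff_subset finite_subset[of S A])
  qed
  finally show ?thesis
    using A s by (simp add: card_subsets_between)
qed

section \<open>Exponential generating function of the Stirling numbers\<close>

text \<open>The series \<open>?F\<close> has derivative \<open>?F + 1\<close>, so differentiating
  \<open>?F ^ Suc j\<close> yields \<open>Suc j\<close> times \<open>?F ^ Suc j + ?F ^ j\<close>.
  Comparing coefficients reproduces the Stirling recurrence.\<close>

lemma fps_nth_exp_minus_1_power:
  "fps_nth ((fps_exp (1::real) - 1) ^ m) n = fact m * real (Stirling n m) / fact n"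
proof (induction n arbitrary: m)
  case 0
  then show ?case by (cases m) (auto simp: fps_nth_power_0)
next
  case (Suc n)
  let ?F = "fps_exp (1::real) - 1"
  show ?case
  proof (cases m)
    case 0
    then show ?thesis by simp
  next
    case (Suc j)
    have "fps_deriv (?F ^ Suc j) = of_nat (Suc j) * (?F ^ Suc j + ?F ^ j)"
      unfolding fps_deriv_power' by (simp add: algebra_simps)
    then have "real (Suc n) * fps_nth (?F ^ Suc j) (Suc n)
        = real (Suc j) * (fps_nth (?F ^ Suc j) n + fps_nth (?F ^ j) n)"
      using fps_deriv_nth[of "?F ^ Suc j" n]
      by (simp only: fps_of_nat[symmetric] fps_mult_left_const_nth fps_add_nth) simp
    also have "\<dots> = real (Suc j) * (fact (Suc j) * real (Stirling n (Suc j)) / fact n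
        + fact j * real (Stirling n j) / fact n)"
      by (simp only: Suc.IH)
    also have "\<dots> = fact (Suc j) * real (Stirling (Suc n) (Suc j)) / fact n"
      by (simp add: field_simps)
    finally have "fps_nth (?F ^ Suc j) (Suc n)
        = fact (Suc j) * real (Stirling (Suc n) (Suc j)) / fact n / real (Suc n)"
      by (subst nonzero_eq_divide_eq) (simp_all only: mult.commute of_nat_eq_0_iff nat.simps not_False_eq_True)
    then show ?thesis
      unfolding Suc by (simp only: fact_Suc divide_divide_eq_left) (simp only: of_nat_mult mult.commute)
  qed
qed

text \<open>The binomial theorem expands the power; a factor \<open>fps_X ^ m\<close> shifts the
  coefficients of \<open>exp_z\<close> by \<open>m\<close>, and \<open>inv_fact\<close> supplies the
  value 0 for \<open>s < m\<close>.\<close>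

lemma coeff_gen_fun:
  "fps_nth (fps_nth (gen_fun r) s) n
    = (\<Sum>m\<le>r. real (r choose m) * (fact m * real (Stirling n m) / fact n) * inv_fact (int s - int m))"
proof -
  let ?E = "fps_exp (1::real) - 1"
  \<comment> \<open>The part in \<open>u\<close> is constant in \<open>z\<close>, so its powers can
    be taken in the inner ring of series.\<close>
  have E: "exp_u - 1 = fps_const ?E"
    unfolding exp_u_def by (simp flip: fps_const_sub)
  have "gen_fun r = (\<Sum>m\<le>r. of_nat (r choose m) * (fps_X * fps_const ?E) ^ m * exp_z)"
    unfolding gen_fun_def E
    by (subst add.commute, subst binomial_ring) (simp add: sum_distrib_right mult.commute[of exp_z])
  also have "\<dots> = (\<Sum>m\<le>r. fps_X ^ m * (fps_const (of_nat (r choose m) * ?E ^ m) * exp_z))"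
    by (intro sum.cong refl)
      (simp add: power_mult_distrib fps_const_power mult_ac flip: fps_const_mult fps_of_nat)
  finally have "fps_nth (gen_fun r) s
      = (\<Sum>m\<le>r. if s < m then 0 else of_nat (r choose m) * ?E ^ m * fps_nth exp_z (s - m))"
    by (simp only: fps_sum_nth fps_X_power_mult_nth fps_mult_left_const_nth)
  also have "fps_nth \<dots> n
      = (\<Sum>m\<le>r. if s < m then 0 else real (r choose m) * fps_nth (?E ^ m) n * (1 / fact (s - m)))"
    unfolding fps_sum_nth
    by (intro sum.cong refl)
      (auto simp: exp_z_def mult.assoc simp flip: fps_of_nat)
  also have "\<dots> = (\<Sum>m\<le>r. real (r choose m) * (fact m * real (Stirling n m) / fact n)
      * inv_fact (int s - int m))"
    unfolding fps_nth_exp_minus_1_power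
    by (intro sum.cong refl) (auto simp: inv_fact_def nat_diff_distrib')
  finally show ?thesis .
qed

section \<open>The legs of the Burnside kernels\<close>

lemma finite_words: "finite (words k n)"
  unfolding words_def using finite_lists_card_set[of "{1..k}" n "\<lambda>_. True"] by simp

lemma finite_Sym: "finite (Sym k)"
  unfolding Sym_def by (simp add: finite_permutations)

lemma finite_Sym_star: "finite (Sym_star k)"
  unfolding Sym_star_def using finite_Sym by simp

lemma map_eq_self_iff: "map g xs = xs \<longleftrightarrow> (\<forall>a\<in>set xs. g a = a)"
  by (induction xs) auto

lemma fixed_words_eq: "fixed_words k n g = {x. length x = n \<and> set x \<subseteq> Fix k g}"
  unfolding fixed_words_def words_def Fix_def by (auto simp: map_eq_self_iff)

lemma card_fixed_words: "card (fixed_words k n g) = card (Fix k g) ^ n"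
  unfolding fixed_words_eq using card_lists_length_eq[of "Fix k g" n]
  by (simp add: Fix_def conj_commute)

lemma stabilizer_eq: "stabilizer k x = {g. g permutes {1..k} \<and> (\<forall>a\<in>set x. g a = a)}"
  unfolding stabilizer_def Sym_def by (auto simp: map_eq_self_iff)

lemma card_stabilizer:
  assumes "x \<in> words k n"
  shows "card (stabilizer k x) = fact (k - distinct_symbols x)"
proof -
  have "stabilizer k x = {g. g permutes {1..k} - set x}"
    using assms unfolding stabilizer_eq words_def by (subst permutes_fixing_iff) auto
  then show ?thesis
    using assms unfolding distinct_symbols_def words_def
    by (simp add: card_permutations card_Diff_subset)
qed

text \<open>For \<open>n \<ge> 1\<close> a word has a first symbol, and every permutation
  stabilizing the word fixes it. Restricting to \<open>Sym_star k\<close> thus loses nothing of a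
  stabilizer.\<close>

lemma stabilizer_subset_Sym_star:
  assumes "x \<in> words k n" "n \<ge> 1"
  shows "stabilizer k x \<subseteq> Sym_star k"
proof -
  have "hd x \<in> set x" using assms by (auto simp: words_def intro: hd_in_set)
  then show ?thesis
    using assms unfolding stabilizer_eq Sym_star_def Sym_def Fix_def words_def
    by (auto intro!: exI[of _ "hd x"])
qed

lemma card_Fix_pos: "g \<in> Sym_star k \<Longrightarrow> card (Fix k g) > 0"
  unfolding Sym_star_def by (auto simp: card_gt_0_iff Fix_def)

lemma fixed_words_iff_stabilizer:
  "x \<in> words k n \<Longrightarrow> g \<in> Sym k \<Longrightarrow> x \<in> fixed_words k n g \<longleftrightarrow> g \<in> stabilizer k x"
  unfolding fixed_words_def stabilizer_def by auto

section \<open>Factorization of both kernels through the legs\<close>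

lemma burnside_Q_eq:
  assumes "h \<in> Sym_star k"
  shows "burnside_Q k n g h = (\<Sum>x\<in>words k n. leg_A k n g x * leg_B k x h)"
proof -
  \<comment> \<open>For a word not fixed by both \<open>g\<close> and \<open>h\<close>, one of the
    two legs vanishes.\<close>
  have "(\<Sum>x\<in>words k n. leg_A k n g x * leg_B k x h)
      = (\<Sum>x\<in>fixed_words k n g \<inter> fixed_words k n h. leg_A k n g x * leg_B k x h)"
    using assms finite_words
    by (intro sum.mono_neutral_right)
      (auto simp: leg_A_def leg_B_def fixed_words_def stabilizer_def)
  also have "\<dots> = (\<Sum>x\<in>fixed_words k n g \<inter> fixed_words k n h.
      1 / real (card (fixed_words k n g)) * (1 / real (card (stabilizer k x))))"
    using assms by (intro sum.cong refl)
      (auto simp: leg_A_def leg_B_def fixed_words_def stabilizer_def Sym_star_def)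
  finally show ?thesis
    unfolding burnside_Q_def by (simp add: sum_distrib_left)
qed

lemma burnside_K_eq:
  assumes "x \<in> words k n" "y \<in> words k n" "n \<ge> 1"
  shows "burnside_K k n x y = (\<Sum>g\<in>Sym_star k. leg_B k x g * leg_A k n g y)"
proof -
  \<comment> \<open>Stabilizers lie inside \<open>Sym_star k\<close>, so the sum sees all of
    \<open>stabilizer k x \<inter> stabilizer k y\<close>; elsewhere a leg vanishes.\<close>
  have "(\<Sum>g\<in>Sym_star k. leg_B k x g * leg_A k n g y)
      = (\<Sum>g\<in>stabilizer k x \<inter> stabilizer k y. leg_B k x g * leg_A k n g y)"
    using assms finite_Sym_star stabilizer_subset_Sym_star[of x k n]
    by (intro sum.mono_neutral_right)
      (auto simp: leg_A_def leg_B_def fixed_words_def stabilizer_def Sym_star_def)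
  also have "\<dots> = (\<Sum>g\<in>stabilizer k x \<inter> stabilizer k y.
      1 / real (card (stabilizer k x)) * (1 / real (card (fixed_words k n g))))"
    using assms by (intro sum.cong refl)
      (auto simp: leg_A_def leg_B_def fixed_words_def stabilizer_def)
  finally show ?thesis
    unfolding burnside_K_def by (simp add: sum_distrib_left)
qed

lemma binom_of_nat: "binom (int a) (int b) = a choose b"
  unfolding binom_def by (auto simp: binomial_eq_0)

text \<open>The words of the block fixed by \<open>g\<close> are the words over
  \<open>Fix k g\<close> with \<open>m\<close> symbols, so the sum is their share among all
  \<open>card (Fix k g) ^ n\<close> fixed words.\<close>

lemma sum_leg_A_P_block:
  "(\<Sum>x\<in>P_block k n m. leg_A k n g x) = A_bar n (card (Fix k g)) m"
proof -
  have fin: "finite (P_block k n m)"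
    unfolding P_block_def using finite_words by simp
  have eq: "P_block k n m \<inter> fixed_words k n g
      = {x. length x = n \<and> set x \<subseteq> Fix k g \<and> card (set x) = m}"
    unfolding P_block_def fixed_words_eq words_def distinct_symbols_def Fix_def by auto
  have "(\<Sum>x\<in>P_block k n m. leg_A k n g x)
      = real (card (P_block k n m \<inter> fixed_words k n g)) / real (card (fixed_words k n g))"
    unfolding leg_A_def using fin by (simp flip: sum_divide_distrib)
  also have "\<dots> = A_bar n (card (Fix k g)) m"
    unfolding eq A_bar_def binom_of_nat
    by (subst card_lists_card_set) (auto simp: Fix_def card_fixed_words[unfolded Fix_def])
  finally show ?thesis .
qed

text \<open>A positive number of fixed points already forces membership in
  \<open>Sym_star k\<close>, which leaves a plain count of permutations.\<close>

lemma C_block_eq: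
  assumes "s \<ge> 1"
  shows "C_block k s = {g. g permutes {1..k} \<and> card {a\<in>{1..k}. g a = a} = s}"
proof -
  have "{a\<in>{1..k}. g a = a} \<noteq> {}" if "card {a\<in>{1..k}. g a = a} = s" for g
    using assms that by (metis card.empty not_one_le_zero)
  then show ?thesis
    unfolding C_block_def Sym_star_def Sym_def Fix_def by blast
qed

lemma finite_C_block: "finite (C_block k s)"
  unfolding C_block_def using finite_Sym_star by simp

lemma sum_leg_B_C_block:
  assumes x: "x \<in> words k n" and s: "s \<ge> 1"
  shows "(\<Sum>g\<in>C_block k s. leg_B k x g) = B_bar k (distinct_symbols x) s"
proof -
  let ?m = "distinct_symbols x"
  let ?N = "{g. g permutes {1..k} \<and> (\<forall>a\<in>set x. g a = a) \<and> card {a\<in>{1..k}. g a = a} = s}"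
  have m: "?m \<le> k"
    using x card_mono[of "{1..k}" "set x"] by (auto simp: words_def distinct_symbols_def)
  have eq: "C_block k s \<inter> stabilizer k x = ?N"
    unfolding C_block_eq[OF s] stabilizer_eq by blast
  have "(\<Sum>g\<in>C_block k s. leg_B k x g)
      = real (card (C_block k s \<inter> stabilizer k x)) / real (card (stabilizer k x))"
    unfolding leg_B_def using finite_C_block by (simp flip: sum_divide_distrib)
  also have "\<dots> = B_bar k ?m s"
  proof (cases "?m \<le> s")
    case True
    have "card ?N = ((k - ?m) choose (s - ?m)) * derangement_number (k - s)"
      using card_permutations_fixing[of "{1..k}" "set x" s] x True
      by (simp add: words_def distinct_symbols_def)
    moreover have "binom (int k - int ?m) (int s - int ?m) = (k - ?m) choose (s - ?m)"
      using m True binom_of_nat[of "k - ?m" "s - ?m"] by (simp add: of_nat_diff)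
    ultimately show ?thesis
      unfolding eq B_bar_def by (simp add: card_stabilizer[OF x])
  next
    case False
    \<comment> \<open>Stabilizing \<open>x\<close> costs at least \<open>?m\<close> fixed points. On
      the other side \<open>binom\<close> has a negative lower argument and is 0.\<close>
    have "?N = {}"
    proof -
      have "?m \<le> s" if "g \<in> ?N" for g
      proof -
        have "set x \<subseteq> {a\<in>{1..k}. g a = a}" using that x by (auto simp: words_def)
        then have "?m \<le> card {a\<in>{1..k}. g a = a}"
          unfolding distinct_symbols_def by (intro card_mono) auto
        then show ?thesis using that by simp
      qed
      then show ?thesis using False by blast
    qed
    then have "card ?N = 0"
      by (simp only: card.empty)
    then show ?thesis
      using False unfolding eq B_bar_def binom_def by simp
  qed
  finally show ?thesis .
qed

lemma sum_leg_A:
  assumes "g \<in> Sym_star k"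
  shows "(\<Sum>x\<in>words k n. leg_A k n g x) = 1"
proof -
  have "(\<Sum>x\<in>words k n. leg_A k n g x)
      = real (card (words k n \<inter> fixed_words k n g)) / real (card (fixed_words k n g))"
    unfolding leg_A_def using finite_words by (simp flip: sum_divide_distrib)
  also have "words k n \<inter> fixed_words k n g = fixed_words k n g"
    unfolding fixed_words_def by auto
  finally show ?thesis
    using card_Fix_pos[OF assms] by (simp add: card_fixed_words)
qed

lemma sum_leg_B:
  assumes "x \<in> words k n" "n \<ge> 1"
  shows "(\<Sum>g\<in>Sym_star k. leg_B k x g) = 1"
proof -
  have "(\<Sum>g\<in>Sym_star k. leg_B k x g)
      = real (card (Sym_star k \<inter> stabilizer k x)) / real (card (stabilizer k x))"
    unfolding leg_B_def using finite_Sym_star by (simp flip: sum_divide_distrib)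
  also have "Sym_star k \<inter> stabilizer k x = stabilizer k x"
    using stabilizer_subset_Sym_star[OF assms] by auto
  finally show ?thesis
    by (simp add: card_stabilizer[OF assms(1)])
qed

text \<open>If \<open>g\<close> fixes \<open>x\<close>, the normalization of each leg cancels the
  numerator of its law and both sides are \<open>1 / (fact k * Z_num k n)\<close>; otherwise both
  are 0.\<close>

lemma pi_leg_balance:
  assumes "g \<in> Sym_star k" "x \<in> words k n"
  shows "pi_Q k n g * leg_A k n g x = pi_K k n x * leg_B k x g"
proof -
  have "x \<in> fixed_words k n g \<longleftrightarrow> g \<in> stabilizer k x"
    using assms by (intro fixed_words_iff_stabilizer) (auto simp: Sym_star_def)
  then show ?thesis
    using assms card_Fix_pos[OF assms(1)]
    unfolding pi_Q_def pi_K_def leg_A_def leg_B_def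
    by (simp add: card_fixed_words card_stabilizer)
qed

section \<open>Block sizes and lumped laws\<close>

lemma card_P_block: "card (P_block k n m) = (k choose m) * fact m * Stirling n m"
  unfolding P_block_def words_def distinct_symbols_def
  using card_lists_card_set[of "{1..k}" n m] by (simp add: conj_assoc)

lemma card_C_block:
  assumes "s \<ge> 1"
  shows "card (C_block k s) = (k choose s) * derangement_number (k - s)"
  unfolding C_block_eq[OF assms] using card_permutations_fixing[of "{1..k}" "{}" s] by simp

lemma pi_K_bar_eq:
  assumes "m \<le> k"
  shows "pi_K_bar k n m = real (Stirling n m) / real (Z_num k n)"
proof -
  have "pi_K_bar k n m = (\<Sum>x\<in>P_block k n m. fact (k - m) / (fact k * real (Z_num k n)))"
    unfolding pi_K_bar_def lumped_law_def
    by (intro sum.cong refl) (simp add: pi_K_def P_block_def)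
  also have "\<dots> = real (k choose m) * fact m * fact (k - m) / fact k
      * (real (Stirling n m) / real (Z_num k n))"
    by (simp add: card_P_block)
  \<comment> \<open>Choosing and ordering \<open>m\<close> symbols and then ordering the rest orders
    all \<open>k\<close> symbols, so only the Stirling number survives.\<close>
  also have "real (k choose m) * fact m * fact (k - m) / fact k = 1"
    using assms by (simp add: binomial_fact)
  finally show ?thesis by simp
qed

lemma pi_Q_bar_eq:
  assumes "s \<ge> 1"
  shows "pi_Q_bar k n s
    = real (k choose s) * real (derangement_number (k - s)) * real s ^ n / (fact k * real (Z_num k n))"
proof -
  have "pi_Q_bar k n s = (\<Sum>g\<in>C_block k s. real s ^ n / (fact k * real (Z_num k n)))"
    unfolding pi_Q_bar_def lumped_law_def
    by (intro sum.cong refl) (simp add: pi_Q_def C_block_def)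
  then show ?thesis by (simp add: card_C_block[OF assms])
qed

lemma theta_fact:
  assumes "s \<le> k"
  shows "theta k s / fact s = real (k choose s) * real (derangement_number (k - s)) / fact k"
  using assms by (simp add: theta_def binomial_fact)

text \<open>Cancelling \<open>fact (k - m)\<close> leaves a single reciprocal factorial depending on
  \<open>m\<close>, so \<open>theta k s\<close> can leave a sum over \<open>m\<close>.\<close>

lemma B_bar_eq:
  assumes "m \<le> k" "s \<le> k"
  shows "B_bar k m s = theta k s * inv_fact (int s - int m)"
proof (cases "m \<le> s")
  case True
  then have "binom (int k - int m) (int s - int m) = (k - m) choose (s - m)"
    using assms binom_of_nat[of "k - m" "s - m"] by (simp add: of_nat_diff)
  moreover have "real ((k - m) choose (s - m)) = fact (k - m) / (fact (s - m) * fact (k - s))"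
    using True assms by (subst binomial_fact) auto
  ultimately show ?thesis
    using True by (simp add: B_bar_def theta_def inv_fact_def nat_diff_distrib')
next
  case False
  then show ?thesis by (simp add: B_bar_def binom_def inv_fact_def)
qed

section \<open>The block partitions and their label sets\<close>

lemma indexed_partition_C_block:
  "indexed_partition (Sym_star k) (I_labels k) (C_block k)"
proof -
  have "card (Fix k g) \<in> I_labels k" if g: "g \<in> Sym_star k" for g
  proof -
    let ?s = "card (Fix k g)"
    have s1: "?s \<ge> 1" using card_Fix_pos[OF g] by simp
    have sk: "?s \<le> k" using card_mono[of "{1..k}" "Fix k g"] unfolding Fix_def by fastforce
    have "card (C_block k ?s) > 0"
      using g finite_C_block by (subst card_gt_0_iff) (auto simp: C_block_def)
    then have "derangement_number (k - ?s) > 0"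
      by (simp add: card_C_block[OF s1])
    \<comment> \<open>No permutation moves exactly one point; this is why the label
      \<open>k - 1\<close> is left out.\<close>
    moreover have "derangement_number 1 = 0"
      by (auto simp: derangement_number_def dest: permutes_in_image)
    ultimately have "k - ?s \<noteq> 1" by (metis less_irrefl)
    then show ?thesis using s1 sk by (auto simp: I_labels_def)
  qed
  moreover have "\<exists>g\<in>Sym_star k. card (Fix k g) = s" if s: "s \<in> I_labels k" for s
  proof -
    have "s \<ge> 1" "s \<le> k" "k - s \<noteq> 1" using s by (auto simp: I_labels_def)
    \<comment> \<open>Every other label is attained, since derangements exist in every size except
      1.\<close>
    then have "card (C_block k s) > 0"
      using derangement_number_pos by (simp add: card_C_block)
    then show ?thesis by (auto simp: card_gt_0_iff C_block_def)
  qed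
  ultimately show ?thesis
    using indexed_partition_fibres[of "Sym_star k" "\<lambda>g. card (Fix k g)" "I_labels k"]
    unfolding C_block_def[abs_def] by blast
qed

lemma Stirling_pos: "1 \<le> m \<Longrightarrow> m \<le> n \<Longrightarrow> Stirling n m > 0"
  by (induction n m rule: Stirling.induct) (auto simp: le_Suc_eq)

lemma indexed_partition_P_block:
  assumes "n \<ge> 1"
  shows "indexed_partition (words k n) (M_labels k n) (P_block k n)"
proof -
  have "distinct_symbols x \<in> M_labels k n" if x: "x \<in> words k n" for x
  proof -
    have "x \<noteq> []" using x assms by (auto simp: words_def)
    then have "card (set x) \<ge> 1" by (simp add: Suc_le_eq card_gt_0_iff)
    moreover have "card (set x) \<le> k" "card (set x) \<le> n"
      using x card_mono[of "{1..k}" "set x"] card_length[of x] by (auto simp: words_def)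
    ultimately show ?thesis by (simp add: M_labels_def distinct_symbols_def)
  qed
  moreover have "\<exists>x\<in>words k n. distinct_symbols x = m" if m: "m \<in> M_labels k n" for m
  proof -
    have "card (P_block k n m) > 0"
      using m Stirling_pos[of m n] by (auto simp: card_P_block M_labels_def)
    then show ?thesis by (auto simp: card_gt_0_iff P_block_def)
  qed
  ultimately show ?thesis
    using indexed_partition_fibres[of "words k n" distinct_symbols "M_labels k n"]
    unfolding P_block_def[abs_def] by blast
qed

section \<open>Closed forms of the lumped dual kernel\<close>

lemma sum_A_bar_eq:
  assumes "r \<in> I_labels k" "s \<in> I_labels k"
  shows "(\<Sum>m\<in>M_labels k n. A_bar n r m * B_bar k m s)
    = theta k s * (1 / real r ^ n) * (\<Sum>m = 1..min k n.
        real (r choose m) * real (Stirling n m) * fact m * inv_fact (int s - int m))"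
proof -
  have "A_bar n r m * B_bar k m s = theta k s * (1 / real r ^ n) *
        (real (r choose m) * real (Stirling n m) * fact m * inv_fact (int s - int m))"
    if "m \<in> {1..min k n}" for m
    using that assms by (simp add: A_bar_def B_bar_eq binom_of_nat I_labels_def)
  then show ?thesis
    unfolding M_labels_def sum_distrib_left by (rule sum.cong[OF refl])
qed

text \<open>The binomial kills \<open>m > r\<close> and \<open>inv_fact\<close> kills
  \<open>m > s\<close>; on the remaining range \<open>s - m\<close> is not truncated.\<close>

lemma sum_inv_fact_eq_min:
  assumes "r \<le> k"
  shows "(\<Sum>m = 1..min k n. real (r choose m) * real (Stirling n m) * fact m * inv_fact (int s - int m))
    = (\<Sum>m = 1..Min {r, s, n}. real (r choose m) * real (Stirling n m) * (fact m / fact (s - m)))"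
  using assms
  by (intro sum.mono_neutral_cong_right)
    (auto simp: inv_fact_def nat_diff_distrib' binomial_eq_0 not_le)

text \<open>The two ranges differ by zero terms only: the Stirling number vanishes for
  \<open>m = 0\<close>, as \<open>n \<ge> 1\<close>, and for \<open>m > n\<close>, the binomial for
  \<open>m > r\<close>.\<close>

lemma sum_inv_fact_eq_atMost:
  assumes "r \<le> k" "n \<ge> 1"
  shows "(\<Sum>m = 1..min k n. real (r choose m) * real (Stirling n m) * fact m * inv_fact (int s - int m))
    = (\<Sum>m\<le>r. real (r choose m) * real (Stirling n m) * fact m * inv_fact (int s - int m))"
proof (rule sum.mono_neutral_cong)
  show "real (r choose m) * real (Stirling n m) * fact m * inv_fact (int s - int m) = 0"
    if "m \<in> {..r} - {1..min k n}" for m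
    using that assms by (cases n; cases m) (auto simp: not_le)
qed (use assms in \<open>auto simp: binomial_eq_0\<close>)

text \<open>Words are grouped by their number of symbols; the groups are the blocks
  \<open>P_block r n m\<close>, with \<open>r\<close> as the alphabet size.\<close>

lemma expectation_R_law:
  assumes "r \<ge> 1"
  shows "measure_pmf.expectation (R_law r n) f
    = (1 / real r ^ n) * (\<Sum>m\<le>r. real (r choose m) * real (Stirling n m) * fact m * (f m :: real))"
proof -
  have ne: "words r n \<noteq> {}"
    using assms by (auto simp: words_def intro!: exI[of _ "replicate n 1"])
  have card: "card (words r n) = r ^ n"
    using card_lists_length_eq[of "{1..r}" n] by (simp add: words_def conj_commute)
  have "measure_pmf.expectation (R_law r n) f = (\<Sum>x\<in>words r n. f (distinct_symbols x)) / real r ^ n"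
    unfolding R_law_def using integral_pmf_of_set[OF ne finite_words] card by simp
  also have "(\<Sum>x\<in>words r n. f (distinct_symbols x))
      = (\<Sum>m\<le>r. \<Sum>x\<in>{x \<in> words r n. distinct_symbols x = m}. f (distinct_symbols x))"
    using finite_words card_mono[of "{1..r}"]
    by (intro sum.group[symmetric]) (auto simp: words_def distinct_symbols_def)
  also have "\<dots> = (\<Sum>m\<le>r. real (card (P_block r n m)) * f m)"
    by (intro sum.cong refl) (simp add: P_block_def)
  finally show ?thesis
    by (simp add: card_P_block mult_ac)
qed

section \<open>Block sums of the legs and of the Burnside kernels\<close>

lemma block_sum_leg_A: "g \<in> C_block k r \<Longrightarrow> (\<Sum>x\<in>P_block k n m. leg_A k n g x) = A_bar n r m"
  by (simp add: sum_leg_A_P_block C_block_def)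

lemma block_sum_leg_B:
  "s \<in> I_labels k \<Longrightarrow> x \<in> P_block k n m \<Longrightarrow> (\<Sum>g\<in>C_block k s. leg_B k x g) = B_bar k m s"
  by (auto simp: sum_leg_B_C_block P_block_def I_labels_def)

text \<open>Compatibility of the legs passes to their compositions: the dual kernel is summed
  through the blocks of words, the classical one through the blocks of permutations.\<close>

lemma
  assumes "n \<ge> 1"
  shows block_sum_burnside_Q: "\<lbrakk>r \<in> I_labels k; s \<in> I_labels k; g \<in> C_block k r\<rbrakk>
      \<Longrightarrow> (\<Sum>h\<in>C_block k s. burnside_Q k n g h) = (\<Sum>m\<in>M_labels k n. A_bar n r m * B_bar k m s)"
    and block_sum_burnside_K: "\<lbrakk>m \<in> M_labels k n; m' \<in> M_labels k n; x \<in> P_block k n m\<rbrakk>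
      \<Longrightarrow> (\<Sum>y\<in>P_block k n m'. burnside_K k n x y) = (\<Sum>s\<in>I_labels k. B_bar k m s * A_bar n s m')"
proof -
  assume r: "r \<in> I_labels k" "s \<in> I_labels k" "g \<in> C_block k r"
  have "(\<Sum>h\<in>C_block k s. burnside_Q k n g h)
      = (\<Sum>h\<in>C_block k s. \<Sum>x\<in>words k n. leg_A k n g x * leg_B k x h)"
    by (intro sum.cong refl burnside_Q_eq) (simp add: C_block_def)
  also have "\<dots> = (\<Sum>m\<in>M_labels k n. A_bar n r m * B_bar k m s)"
    using r assms
    by (intro block_sum_kernel_comp[OF finite_words indexed_partition_P_block])
      (auto simp: block_sum_leg_A block_sum_leg_B)
  finally show "(\<Sum>h\<in>C_block k s. burnside_Q k n g h)
    = (\<Sum>m\<in>M_labels k n. A_bar n r m * B_bar k m s)" .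
next
  assume m: "m \<in> M_labels k n" "m' \<in> M_labels k n" "x \<in> P_block k n m"
  have "(\<Sum>y\<in>P_block k n m'. burnside_K k n x y)
      = (\<Sum>y\<in>P_block k n m'. \<Sum>g\<in>Sym_star k. leg_B k x g * leg_A k n g y)"
    using m assms by (intro sum.cong refl burnside_K_eq) (auto simp: P_block_def)
  also have "\<dots> = (\<Sum>s\<in>I_labels k. B_bar k m s * A_bar n s m')"
    using m
    by (intro block_sum_kernel_comp[OF finite_Sym_star indexed_partition_C_block])
      (auto simp: block_sum_leg_A block_sum_leg_B)
  finally show "(\<Sum>y\<in>P_block k n m'. burnside_K k n x y)
    = (\<Sum>s\<in>I_labels k. B_bar k m s * A_bar n s m')" .
qed

section \<open>Normalization and stationarity of both laws\<close>

lemma Z_num_eq: "n \<ge> 1 \<Longrightarrow> Z_num k n = (\<Sum>m\<in>M_labels k n. Stirling n m)"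
  unfolding Z_num_def M_labels_def by (cases n) (auto simp: sum.atLeast_Suc_atMost)

lemma Z_num_pos:
  assumes "k \<ge> 1" "n \<ge> 1"
  shows "Z_num k n > 0"
proof -
  have "Stirling n 1 \<le> Z_num k n"
    unfolding Z_num_def using assms by (intro member_le_sum) auto
  then show ?thesis using Stirling_pos[of 1 n] assms by linarith
qed

text \<open>The mass is computed after lumping, where block \<open>m\<close> weighs
  \<open>Stirling n m / Z_num k n\<close>.\<close>

lemma sum_pi_K:
  assumes "k \<ge> 1" "n \<ge> 1"
  shows "(\<Sum>x\<in>words k n. pi_K k n x) = 1"
proof -
  have "(\<Sum>x\<in>words k n. pi_K k n x) = (\<Sum>m\<in>M_labels k n. pi_K_bar k n m)"
    unfolding pi_K_bar_def lumped_law_def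
    by (rule sum_indexed_partition[OF finite_words indexed_partition_P_block[OF assms(2)]])
  also have "\<dots> = (\<Sum>m\<in>M_labels k n. real (Stirling n m)) / real (Z_num k n)"
    unfolding sum_divide_distrib by (intro sum.cong refl pi_K_bar_eq) (simp add: M_labels_def)
  also have "\<dots> = 1"
    using Z_num_pos[OF assms] by (simp add: Z_num_eq[OF assms(2)] flip: of_nat_sum)
  finally show ?thesis .
qed

text \<open>Summing the balance over all pairs carries the total mass of \<open>pi_K\<close> over to
  \<open>pi_Q\<close>, because the rows of both legs sum to 1.\<close>

lemma sum_pi_Q:
  assumes "k \<ge> 1" "n \<ge> 1"
  shows "(\<Sum>g\<in>Sym_star k. pi_Q k n g) = 1"
proof -
  have "(\<Sum>g\<in>Sym_star k. pi_Q k n g) = (\<Sum>g\<in>Sym_star k. \<Sum>x\<in>words k n. pi_Q k n g * leg_A k n g x)"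
    by (intro sum.cong refl) (simp add: sum_leg_A flip: sum_distrib_left)
  also have "\<dots> = (\<Sum>g\<in>Sym_star k. \<Sum>x\<in>words k n. pi_K k n x * leg_B k x g)"
    by (intro sum.cong refl pi_leg_balance)
  also have "\<dots> = (\<Sum>x\<in>words k n. pi_K k n x * (\<Sum>g\<in>Sym_star k. leg_B k x g))"
    by (subst sum.swap) (simp add: sum_distrib_left)
  also have "\<dots> = (\<Sum>x\<in>words k n. pi_K k n x)"
    using assms by (intro sum.cong refl) (simp add: sum_leg_B)
  finally show ?thesis using sum_pi_K[OF assms] by simp
qed

lemma stationary_law_burnside_Q:
  assumes "k \<ge> 1" "n \<ge> 1"
  shows "stationary_law (Sym_star k) (burnside_Q k n) (pi_Q k n)"
  using assms
  by (intro stationary_law_comp[where T = "words k n" and A = "leg_A k n" and B = "leg_B k"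
        and q = "pi_K k n"] burnside_Q_eq sum_leg_A sum_leg_B[where n = n] pi_leg_balance sum_pi_Q) (auto simp: pi_Q_def)

text \<open>The legs exchange roles, and the balance is read from right to left.\<close>

lemma stationary_law_burnside_K:
  assumes "k \<ge> 1" "n \<ge> 1"
  shows "stationary_law (words k n) (burnside_K k n) (pi_K k n)"
  using assms
  by (intro stationary_law_comp[where T = "Sym_star k" and A = "leg_B k" and B = "leg_A k n"
        and q = "pi_Q k n"] burnside_K_eq sum_leg_A sum_leg_B[where n = n] pi_leg_balance[symmetric] sum_pi_K) (auto simp: pi_K_def)

theorem theorem4p11:
  fixes k n :: nat
  assumes "k \<ge> 2" and "n \<ge> 1"
  shows
    "(indexed_partition (Sym_star k) (I_labels k) (C_block k)) \<and>
     (indexed_partition (words k n) (M_labels k n) (P_block k n)) \<and>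
     (compatible (I_labels k) (C_block k) (M_labels k n) (P_block k n) (leg_A k n) (leg_B k)) \<and>
     (strongly_lumpable (I_labels k) (C_block k) (burnside_Q k n)) \<and>
     (strongly_lumpable (M_labels k n) (P_block k n) (burnside_K k n)) \<and>
     (\<forall>r\<in>I_labels k. \<forall>s\<in>I_labels k. Q_bar k n r s = (\<Sum>m\<in>M_labels k n. A_bar n r m * B_bar k m s)) \<and>
     (\<forall>m\<in>M_labels k n. \<forall>m'\<in>M_labels k n. K_bar k n m m' = (\<Sum>s\<in>I_labels k. B_bar k m s * A_bar n s m')) \<and>
     (kernel_Spec_nz (I_labels k) (Q_bar k n) = kernel_Spec_nz (M_labels k n) (K_bar k n)) \<and>
     (kernel_Spec (I_labels k) (Q_bar k n) \<subseteq> kernel_Spec (Sym_star k) (burnside_Q k n)) \<and>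
     (kernel_Spec (M_labels k n) (K_bar k n) \<subseteq> kernel_Spec (words k n) (burnside_K k n)) \<and>
     (\<forall>r\<in>I_labels k. \<forall>s\<in>I_labels k.
       Q_bar k n r s =
         theta k s * (1 / real r ^ n) *
           (\<Sum>m = 1..Min {r, s, n}. real (r choose m) * real (Stirling n m) * (fact m / fact (s - m)))) \<and>
     (\<forall>r\<in>I_labels k. \<forall>s\<in>I_labels k.
       Q_bar k n r s =
         theta k s * measure_pmf.expectation (R_law r n) (\<lambda>R. inv_fact (int s - int R))) \<and>
     (\<forall>r\<in>I_labels k. \<forall>s\<in>I_labels k.
       Q_bar k n r s = theta k s * (fact n / real r ^ n) * fps_nth (fps_nth (gen_fun r) s) n) \<and>
     (stationary_law (I_labels k) (Q_bar k n) (pi_Q_bar k n)) \<and>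
     (stationary_law (M_labels k n) (K_bar k n) (pi_K_bar k n)) \<and>
     (\<forall>s\<in>I_labels k.
       pi_Q_bar k n s =
         real (k choose s) * real (derangement_number (k - s)) * real s ^ n / (fact k * real (Z_num k n))) \<and>
     (\<forall>s\<in>I_labels k. pi_Q_bar k n s = theta k s / real (Z_num k n) * (real s ^ n / fact s)) \<and>
     (\<forall>m\<in>M_labels k n. pi_K_bar k n m = real (Stirling n m) / real (Z_num k n))"
proof -
  have k1: "k \<ge> 1" using assms by simp
  note [simp] = finite_Sym_star finite_words
  note C = indexed_partition_C_block[of k]
  note P = indexed_partition_P_block[OF assms(2), of k]
  note block_Q = block_sum_burnside_Q[OF assms(2), where k = k]
  note block_K = block_sum_burnside_K[OF assms(2), where k = k]
  have comp: "compatible (I_labels k) (C_block k) (M_labels k n) (P_block k n) (leg_A k n) (leg_B k)"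
    unfolding compatible_def
    by (simp add: block_sum_leg_A block_sum_leg_B)
  have lump_Q: "strongly_lumpable (I_labels k) (C_block k) (burnside_Q k n)"
    unfolding strongly_lumpable_def using block_Q by simp
  have lump_K: "strongly_lumpable (M_labels k n) (P_block k n) (burnside_K k n)"
    unfolding strongly_lumpable_def using block_K by simp
  \<comment> \<open>The definite description in \<open>lumped\<close> is resolved by constancy of
    the block sums together with nonemptiness of the block.\<close>
  have Q: "Q_bar k n r s = (\<Sum>m\<in>M_labels k n. A_bar n r m * B_bar k m s)"
    if "r \<in> I_labels k" "s \<in> I_labels k" for r s
    unfolding Q_bar_def
    by (rule lumped_eqI) (use that block_Q indexed_partition_nonempty[OF C] in auto)
  have K: "K_bar k n m m' = (\<Sum>s\<in>I_labels k. B_bar k m s * A_bar n s m')"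
    if "m \<in> M_labels k n" "m' \<in> M_labels k n" for m m'
    unfolding K_bar_def
    by (rule lumped_eqI) (use that block_K indexed_partition_nonempty[OF P] in auto)
  \<comment> \<open>Restated with the lumped kernel on the right, as the results on spectra and
    stationary laws require.\<close>
  have block_Q': "(\<Sum>h\<in>C_block k s. burnside_Q k n g h) = Q_bar k n r s"
    if "r \<in> I_labels k" "s \<in> I_labels k" "g \<in> C_block k r" for r s g
    using that by (simp add: Q block_Q)
  have block_K': "(\<Sum>y\<in>P_block k n m'. burnside_K k n x y) = K_bar k n m m'"
    if "m \<in> M_labels k n" "m' \<in> M_labels k n" "x \<in> P_block k n m" for m m' x
    using that by (simp add: K block_K)
  \<comment> \<open>One inclusion for each order of the two legs.\<close>
  have nz: "kernel_Spec_nz (I_labels k) (Q_bar k n) = kernel_Spec_nz (M_labels k n) (K_bar k n)"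
    by (intro equalityI kernel_Spec_nz_comp_subset[where A = "A_bar n" and B = "B_bar k"]
        kernel_Spec_nz_comp_subset[where A = "B_bar k" and B = "A_bar n"] Q K)
  have spec_Q: "kernel_Spec (I_labels k) (Q_bar k n) \<subseteq> kernel_Spec (Sym_star k) (burnside_Q k n)"
    by (rule kernel_Spec_lumped_subset[OF finite_Sym_star C block_Q'])
  have spec_K: "kernel_Spec (M_labels k n) (K_bar k n) \<subseteq> kernel_Spec (words k n) (burnside_K k n)"
    by (rule kernel_Spec_lumped_subset[OF finite_words P block_K'])
  have label_le: "1 \<le> r \<and> r \<le> k" if "r \<in> I_labels k" for r
    using that by (auto simp: I_labels_def)
  \<comment> \<open>Common core of two closed forms: \<open>?S r s\<close> is \<open>r ^ n\<close>
    times the expectation and \<open>fact n\<close> times the coefficient of the generating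
    function.\<close>
  let ?S = "\<lambda>r s. \<Sum>m\<le>r. real (r choose m) * real (Stirling n m) * fact m * inv_fact (int s - int m)"
  have Q_min: "Q_bar k n r s = theta k s * (1 / real r ^ n) *
      (\<Sum>m = 1..Min {r, s, n}. real (r choose m) * real (Stirling n m) * (fact m / fact (s - m)))"
    if "r \<in> I_labels k" "s \<in> I_labels k" for r s
    unfolding Q[OF that] sum_A_bar_eq[OF that] using that by (subst sum_inv_fact_eq_min) (auto dest: label_le)
  have Q_atMost: "Q_bar k n r s = theta k s * (1 / real r ^ n) * ?S r s"
    if "r \<in> I_labels k" "s \<in> I_labels k" for r s
    unfolding Q[OF that] sum_A_bar_eq[OF that]
    using that assms by (subst sum_inv_fact_eq_atMost) (auto dest: label_le)
  have Q_exp: "Q_bar k n r s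
      = theta k s * measure_pmf.expectation (R_law r n) (\<lambda>R. inv_fact (int s - int R))"
    if "r \<in> I_labels k" "s \<in> I_labels k" for r s
    using that label_le[of r] by (simp add: Q_atMost expectation_R_law)
  have Q_gf: "Q_bar k n r s = theta k s * (fact n / real r ^ n) * fps_nth (fps_nth (gen_fun r) s) n"
    if "r \<in> I_labels k" "s \<in> I_labels k" for r s
  proof -
    have S: "fact n * fps_nth (fps_nth (gen_fun r) s) n = ?S r s"
      unfolding coeff_gen_fun sum_distrib_left by (intro sum.cong refl) (simp add: field_simps)
    show ?thesis
      unfolding Q_atMost[OF that] S[symmetric] by simp
  qed
  have stat_Q: "stationary_law (I_labels k) (Q_bar k n) (pi_Q_bar k n)"
    unfolding pi_Q_bar_def
    by (rule stationary_law_lumped[OF finite_Sym_star C block_Q' stationary_law_burnside_Q[OF k1 assms(2)]])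
  have stat_K: "stationary_law (M_labels k n) (K_bar k n) (pi_K_bar k n)"
    unfolding pi_K_bar_def
    by (rule stationary_law_lumped[OF finite_words P block_K' stationary_law_burnside_K[OF k1 assms(2)]])
  have pi_Q: "pi_Q_bar k n s
      = real (k choose s) * real (derangement_number (k - s)) * real s ^ n / (fact k * real (Z_num k n))"
    if "s \<in> I_labels k" for s
    using label_le[OF that] by (simp add: pi_Q_bar_eq)
  have pi_Q': "pi_Q_bar k n s = theta k s / real (Z_num k n) * (real s ^ n / fact s)"
    if "s \<in> I_labels k" for s
  proof -
    \<comment> \<open>Here \<open>theta_fact\<close> absorbs the binomial, the derangement number
      and \<open>fact k\<close>.\<close>
    have "pi_Q_bar k n s = (theta k s / fact s) * (real s ^ n / real (Z_num k n))"
      using label_le[OF that] by (simp add: pi_Q[OF that] theta_fact)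
    then show ?thesis by simp
  qed
  have pi_K: "pi_K_bar k n m = real (Stirling n m) / real (Z_num k n)" if "m \<in> M_labels k n" for m
    using that by (simp add: pi_K_bar_eq M_labels_def)
  show ?thesis
    using C P comp lump_Q lump_K Q K nz spec_Q spec_K Q_min Q_exp Q_gf stat_Q stat_K pi_Q pi_Q' pi_K
    by (intro conjI ballI)
qed

end
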